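(* There exists a constant $C>0$ such that for every positive integer $n$, every $n$-vertex graph $G$ and every edge coloring $\mathcal{F}=(F_1,\dots,F_n)$ of $G$ with $n$ colors, if each color class $F_i$ is either a matching of size $2$ or (the edge set of) a triangle, then the rainbow girth of $\mathcal{F}$ is at most $C\log n$.
   Context: Graphs are finite and simple. An edge coloring of a graph $G$ is a family $\mathcal{F}=(F_1,\dots,F_m)$ of pairwise disjoint nonempty sets of edges with $\bigcup_{i=1}^m F_i=E(G)$; the indices $i$ are the colors and the sets $F_i$ are the color classes. A set of edges $F$ is rainbow for $\mathcal{F}$ if its edges are taken from distinct $F_i$'s, i.e. $|F\cap F_i|\le 1$ for each $i$. The rainbow girth $rgirth(\mathcal{F})$ is the minimum length of a cycle in $G$ whose edge set is rainbow ($\infty$ if there is none). *)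

theory Defs
  imports Complex_Main "HOL-Library.Disjoint_Sets" "HOL-Library.Extended_Real"
begin

definition simple_graph :: "'a set \<Rightarrow> 'a set set \<Rightarrow> bool" where
  "simple_graph V E \<longleftrightarrow> finite V \<and> (\<forall>e\<in>E. e \<subseteq> V \<and> card e = 2)"

definition edge_coloring :: "'a set set \<Rightarrow> nat \<Rightarrow> (nat \<Rightarrow> 'a set set) \<Rightarrow> bool" where
  "edge_coloring E m F \<longleftrightarrow>
     disjoint_family_on F {1..m} \<and> (\<forall>i\<in>{1..m}. F i \<noteq> {}) \<and> (\<Union>i\<in>{1..m}. F i) = E"

definition matching :: "'a set set \<Rightarrow> bool" where
  "matching M \<longleftrightarrow> (\<forall>e\<in>M. card e = 2) \<and> pairwise disjnt M"

definition triangle_edges :: "'a set set \<Rightarrow> bool" where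
  "triangle_edges T \<longleftrightarrow>
     (\<exists>a b c. a \<noteq> b \<and> b \<noteq> c \<and> a \<noteq> c \<and> T = {{a, b}, {b, c}, {a, c}})"

(* A cycle is given by the cyclic list of its vertices, without repeating the first one at
   the end; its length is then the length of the list. *)
definition cycle_edges :: "'a list \<Rightarrow> 'a set set" where
  "cycle_edges c = {{c ! i, c ! (Suc i mod length c)} | i. i < length c}"

definition graph_cycle :: "'a set set \<Rightarrow> 'a list \<Rightarrow> bool" where
  "graph_cycle E c \<longleftrightarrow> 3 \<le> length c \<and> distinct c \<and> cycle_edges c \<subseteq> E"

(* Only meaningful for finite S, since card is 0 on infinite sets; it is applied only to the
   edge sets of cycles. *)
definition rainbow :: "nat \<Rightarrow> (nat \<Rightarrow> 'a set set) \<Rightarrow> 'a set set \<Rightarrow> bool" where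
  "rainbow m F S \<longleftrightarrow> (\<forall>i\<in>{1..m}. card (S \<inter> F i) \<le> 1)"

(* The infimum of the empty set in enat is \<infinity>. *)
definition rgirth :: "'a set set \<Rightarrow> nat \<Rightarrow> (nat \<Rightarrow> 'a set set) \<Rightarrow> enat" where
  "rgirth E m F = Inf {enat (length c) | c. graph_cycle E c \<and> rainbow m F (cycle_edges c)}"

end

theory Submission imports Defs
begin

text \<open>Keep every vertex independently with probability \<open>q\<close>. A color whose class is a
  matching of size 2 keeps one of its edges with probability \<open>2q\<^sup>2 - q\<^sup>4\<close>, and one whose class is
  a triangle with probability \<open>3q\<^sup>2 - 2q\<^sup>3\<close>; at \<open>q = 3/4\<close> both exceed \<open>17/16 q\<close>. So some
  vertex set \<open>W\<close> spans edges of more than \<open>17/16 |W|\<close> different colors. One edge of each of these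
  colors gives a graph all of whose cycles are rainbow. A graph with more than \<open>(1 + \<epsilon>)N\<close> edges on
  \<open>N\<close> vertices has a cycle of logarithmic length: in a vertex-minimal such subgraph every nonempty
  vertex set \<open>S\<close> meets more than \<open>(1 + \<epsilon>)|S|\<close> edges, so that balls grow exponentially as long as
  they are trees.\<close>

section \<open>Short cycles in graphs with linear edge surplus\<close>

definition path :: "'a set set \<Rightarrow> 'a list \<Rightarrow> bool" where
  "path E p \<longleftrightarrow> distinct p \<and> successively (\<lambda>x y. {x, y} \<in> E) p"

lemma path_appendD1: "path E (p @ q) \<Longrightarrow> path E p"
  and path_appendD2: "path E (p @ q) \<Longrightarrow> path E q"
  by (auto simp: path_def successively_append_iff)

lemma cycle_edges_subset:
  assumes "successively (\<lambda>x y. {x, y} \<in> E) c" "c \<noteq> []" "{last c, hd c} \<in> E"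
  shows "cycle_edges c \<subseteq> E"
proof
  fix e assume "e \<in> cycle_edges c"
  then obtain i where i: "i < length c" "e = {c ! i, c ! (Suc i mod length c)}"
    by (auto simp: cycle_edges_def)
  show "e \<in> E"
  proof (cases "Suc i < length c")
    case True
    then show ?thesis using i successively_nth[OF assms(1)] by auto
  next
    case False
    then have "Suc i = length c" using i by simp
    then have "e = {last c, hd c}"
      using i assms(2) by (simp add: last_conv_nth hd_conv_nth flip: \<open>Suc i = length c\<close>)
    then show ?thesis using assms(3) by simp
  qed
qed

text \<open>After their common initial stretch the paths leave some vertex \<open>x\<close> by
  different neighbours. Following one path to its first vertex \<open>z\<close> on the rest of the
  other and returning along that other closes a cycle. It counts \<open>x\<close> and
  \<open>z\<close> once each instead of twice, whence the \<open>+ 2\<close>.\<close>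

lemma cycle_of_two_paths:
  assumes "path E p" "path E q" "p \<noteq> []" "q \<noteq> []" "hd p = hd q" "last p = last q" "p \<noteq> q"
  shows "\<exists>c. graph_cycle E c \<and> length c + 2 \<le> length p + length q"
  using assms
proof (induction p arbitrary: q)
  case (Cons x ps)
  obtain qs where q: "q = x # qs" using Cons.prems by (cases q) auto
  \<comment> \<open>If one path stopped at \<open>x\<close>, the other would end at \<open>x\<close>
    too, and being distinct it would also stop there, making the paths equal.\<close>
  have ne: "ps \<noteq> []" "qs \<noteq> []"
    using Cons.prems q by (auto simp: path_def split: if_splits)
  have pp: "path E ps" "path E qs"
    using Cons.prems path_appendD2[of E "[x]"] by (auto simp: q)
  show ?case
  proof (cases "hd ps = hd qs")
    case True
    then obtain c where "graph_cycle E c" "length c + 2 \<le> length ps + length qs"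
      using Cons.IH[of qs] Cons.prems ne pp q by auto
    then show ?thesis by (auto simp: q)
  next
    case False
    have "\<exists>z\<in>set ps. z \<in> set qs"
      using Cons.prems ne q by (metis last_ConsR last_in_set)
    then obtain P1 z P2 where P: "ps = P1 @ z # P2" "z \<in> set qs" "\<forall>y\<in>set P1. y \<notin> set qs"
      using split_list_first_prop[of ps "\<lambda>y. y \<in> set qs"] by blast
    then obtain Q1 Q2 where Q: "qs = Q1 @ z # Q2" by (meson split_list)
    let ?c = "x # P1 @ z # rev Q1"
    have A: "path E ((x # P1 @ [z]) @ P2)" "path E ((x # Q1 @ [z]) @ Q2)"
      using Cons.prems by (auto simp: q P Q)
    have B: "path E (x # P1 @ [z])" "path E (x # Q1 @ [z])"
      using path_appendD1[OF A(1)] path_appendD1[OF A(2)] by auto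
    have sQ: "successively (\<lambda>x y. {x, y} \<in> E) (z # rev Q1 @ [x])"
    proof -
      have "successively (\<lambda>x y. {x, y} \<in> E) (rev (x # Q1 @ [z]))"
        unfolding successively_rev using B(2) by (simp add: path_def insert_commute)
      then show ?thesis by simp
    qed
    have sP: "successively (\<lambda>x y. {x, y} \<in> E) (x # P1 @ [z])"
      using B(1) by (simp add: path_def)
    have suc: "successively (\<lambda>x y. {x, y} \<in> E) ?c"
      using sP successively_append_iff[of _ "x # P1" "z # rev Q1"]
        successively_append_iff[of _ "x # P1" "[z]"] sQ
        successively_append_iff[of _ "z # rev Q1" "[x]"] by auto
    have cl: "{last ?c, hd ?c} \<in> E"
      using sQ successively_append_iff[of _ "z # rev Q1" "[x]"] by auto
    have "distinct ?c" using B P Q by (auto simp: path_def)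
    moreover have "3 \<le> length ?c"
    proof -
      \<comment> \<open>If both were empty, both paths would go from \<open>x\<close> straight to
        \<open>z\<close>. A third vertex thus keeps the cycle from degenerating to a single
        edge.\<close>
      have "P1 \<noteq> [] \<or> Q1 \<noteq> []" using False P Q by auto
      then show ?thesis by (cases P1; cases Q1) auto
    qed
    moreover have "cycle_edges ?c \<subseteq> E" using cycle_edges_subset[OF suc _ cl] by simp
    ultimately have "graph_cycle E ?c" by (simp add: graph_cycle_def)
    then show ?thesis using q P Q by (intro exI[of _ ?c]) auto
  qed
qed simp

text \<open>The root \<open>v\<close> comes last, so that a path grows at its far end by consing.
  Lists count vertices, so \<open>Suc r\<close> vertices mean radius \<open>r\<close>.\<close>

definition rooted_paths :: "'a set set \<Rightarrow> 'a \<Rightarrow> nat \<Rightarrow> 'a list set" where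
  "rooted_paths E v r = {p. path E p \<and> p \<noteq> [] \<and> last p = v \<and> length p \<le> Suc r}"

definition graph_ball :: "'a set set \<Rightarrow> 'a \<Rightarrow> nat \<Rightarrow> 'a set" where
  "graph_ball E v r = hd ` rooted_paths E v r"

lemma graph_ball_0: "graph_ball E v 0 = {v}"
proof -
  have "rooted_paths E v 0 = {[v]}"
    by (auto simp: rooted_paths_def path_def le_Suc_eq length_Suc_conv)
  then show ?thesis by (simp add: graph_ball_def)
qed

lemma graph_ball_subset:
  assumes "\<And>e. e \<in> E \<Longrightarrow> e \<subseteq> V" "v \<in> V"
  shows "graph_ball E v r \<subseteq> V"
proof -
  have "hd p \<in> V" if "path E p" "p \<noteq> []" "last p = v" for p
  proof (cases p)
    case (Cons x ps)
    then show ?thesis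
      using that assms by (cases ps) (auto simp: path_def)
  qed (use that in simp)
  then show ?thesis by (auto simp: graph_ball_def rooted_paths_def)
qed

text \<open>Without short cycles each vertex of the ball has a unique path to the root, and every edge
  meeting the ball is the first edge of the path of one of its ends.\<close>
lemma card_graph_ball_Suc:
  assumes fin: "finite V" and E: "\<And>e. e \<in> E \<Longrightarrow> e \<subseteq> V \<and> card e = 2" and v: "v \<in> V"
    and no_cycle: "\<And>c. graph_cycle E c \<Longrightarrow> length c > 2 * Suc r"
  shows "card {e \<in> E. e \<inter> graph_ball E v r \<noteq> {}} < card (graph_ball E v (Suc r))"
proof -
  let ?P = "rooted_paths E v (Suc r)"
  \<comment> \<open>Each path has at most \<open>r + 2\<close> vertices, so two different ones would
    give a cycle of length at most \<open>2 * (r + 2) - 2 = 2 * Suc r\<close>.\<close>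
  have uniq: "p = q" if pq: "p \<in> ?P" "q \<in> ?P" "hd p = hd q" for p q
  proof (rule ccontr)
    assume "p \<noteq> q"
    then obtain c where c: "graph_cycle E c" "length c + 2 \<le> length p + length q"
      using cycle_of_two_paths[of E p q] pq by (auto simp: rooted_paths_def)
    then show False using no_cycle[OF c(1)] pq by (auto simp: rooted_paths_def)
  qed
  then have inj: "inj_on hd ?P" by (auto intro: inj_onI)
  have finB: "finite (graph_ball E v (Suc r))"
    using graph_ball_subset[of E V v "Suc r"] E v fin by (meson finite_subset)
  then have finP: "finite ?P"
    using finite_image_iff[OF inj] by (simp add: graph_ball_def)
  have root: "[v] \<in> ?P" by (simp add: rooted_paths_def path_def)
  \<comment> \<open>Edges are charged to paths through their first edge. The path \<open>[v]\<close>
    has none, and leaving it out makes the final inequality strict.\<close>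
  have "{e \<in> E. e \<inter> graph_ball E v r \<noteq> {}} \<subseteq> (\<lambda>p. {hd p, hd (tl p)}) ` (?P - {[v]})"
  proof
    fix e assume "e \<in> {e \<in> E. e \<inter> graph_ball E v r \<noteq> {}}"
    then obtain p where e: "e \<in> E" and p: "p \<in> rooted_paths E v r" "hd p \<in> e"
      by (auto simp: graph_ball_def)
    obtain y where y: "e = {hd p, y}" "y \<noteq> hd p"
      using E[OF e] p(2) by (auto simp: card_2_iff)
    have pp: "path E p" "p \<noteq> []" "last p = v" "length p \<le> Suc r"
      using p by (auto simp: rooted_paths_def)
    have pP: "p \<in> ?P" using pp by (auto simp: rooted_paths_def)
    show "e \<in> (\<lambda>p. {hd p, hd (tl p)}) ` (?P - {[v]})"
    \<comment> \<open>If \<open>y\<close> is off \<open>p\<close>, the edge extends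
      \<open>p\<close>. If \<open>y\<close> is on \<open>p\<close>, jumping to it from
      \<open>hd p\<close> gives another path from \<open>hd p\<close> to the root; uniqueness
      identifies it with \<open>p\<close>, so \<open>y\<close> is the second vertex of
      \<open>p\<close>.\<close>
    proof (cases "y \<in> set p")
      case False
      then have "path E (y # p)"
        using pp e y by (cases p) (auto simp: path_def insert_commute)
      then have "y # p \<in> ?P - {[v]}" using pp by (auto simp: rooted_paths_def)
      moreover have "e = {hd (y # p), hd (tl (y # p))}" using y by auto
      ultimately show ?thesis by (rule rev_image_eqI)
    next
      case True
      then obtain A B where AB: "p = A @ y # B" by (meson split_list)
      then have ne: "A \<noteq> []" using y by auto
      have pB: "path E (y # B)" using pp(1) path_appendD2 AB by blast
      have hdA: "hd p = hd A" "hd A \<notin> set (y # B)" using pp(1) AB ne by (cases A; auto simp: path_def)+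
      have "path E (hd A # y # B)"
        using pB hdA e y by (auto simp: path_def)
      then have "hd A # y # B \<in> ?P"
        using pp AB ne by (cases A) (auto simp: rooted_paths_def)
      then have "p = hd A # y # B" using uniq[OF pP] hdA by simp
      then have "e = {hd p, hd (tl p)}" "p \<noteq> [v]" using y by (metis list.sel(1,3), auto)
      then show ?thesis using pP by blast
    qed
  qed
  then have "card {e \<in> E. e \<inter> graph_ball E v r \<noteq> {}} \<le> card (?P - {[v]})"
    by (rule surj_card_le[OF finite_Diff[OF finP]])
  also have "\<dots> < card ?P" by (rule card_Diff1_less[OF finP root])
  also have "\<dots> = card (graph_ball E v (Suc r))"
    by (simp add: graph_ball_def card_image[OF inj])
  finally show ?thesis .
qed

text \<open>Without such a cycle, passing from radius \<open>s < r\<close> to \<open>Suc s\<close>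
  multiplies the lower bound on the ball by \<open>k\<close>, so the ball of radius \<open>r\<close>
  would outgrow \<open>V\<close>.\<close>

lemma short_cycle_of_expansion:
  fixes k :: real
  assumes fin: "finite V" and E: "\<And>e. e \<in> E \<Longrightarrow> e \<subseteq> V \<and> card e = 2" and v: "v \<in> V"
    and k: "k \<ge> 0"
    and expand: "\<And>S. S \<subseteq> V \<Longrightarrow> S \<noteq> {} \<Longrightarrow> k * card S \<le> card {e \<in> E. e \<inter> S \<noteq> {}}"
    and r: "k ^ r > card V"
  shows "\<exists>c. graph_cycle E c \<and> length c \<le> 2 * r"
proof (rule ccontr)
  assume "\<not> ?thesis"
  then have no: "\<And>c. graph_cycle E c \<Longrightarrow> length c > 2 * r" by (meson not_le)
  have sub: "graph_ball E v s \<subseteq> V" for s using graph_ball_subset E v by metis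
  have "k ^ s \<le> card (graph_ball E v s)" if "s \<le> r" for s
    using that
  proof (induction s)
    case 0
    then show ?case by (simp add: graph_ball_0)
  next
    case (Suc s)
    have IH: "k ^ s \<le> card (graph_ball E v s)" using Suc by simp
    have "[v] \<in> rooted_paths E v s" by (simp add: rooted_paths_def path_def)
    then have "graph_ball E v s \<noteq> {}" by (auto simp: graph_ball_def)
    have "k ^ Suc s \<le> k * card (graph_ball E v s)" using mult_left_mono[OF IH k] by simp
    also have "\<dots> \<le> card {e \<in> E. e \<inter> graph_ball E v s \<noteq> {}}"
      using expand sub \<open>graph_ball E v s \<noteq> {}\<close> by blast
    also have "\<dots> \<le> card (graph_ball E v (Suc s))"
    proof -
      have "length c > 2 * Suc s" if "graph_cycle E c" for c
        using no[OF that] Suc.prems by simp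
      then have "card {e \<in> E. e \<inter> graph_ball E v s \<noteq> {}} < card (graph_ball E v (Suc s))"
        by (intro card_graph_ball_Suc[where V = V]) (use fin E v in auto)
      then show ?thesis by simp
    qed
    finally show ?case .
  qed
  then have "k ^ r \<le> card (graph_ball E v r)" by simp
  also have "\<dots> \<le> card V" using sub fin by (simp add: card_mono)
  finally show False using r by simp
qed

lemma short_cycle_of_surplus:
  fixes k :: real
  assumes fin: "finite V" and E: "\<And>e. e \<in> E \<Longrightarrow> e \<subseteq> V \<and> card e = 2"
    and k: "k \<ge> 0" and surplus: "card E > k * card V" and r: "k ^ r > card V"
  shows "\<exists>c. graph_cycle E c \<and> length c \<le> 2 * r"
proof -
  let ?e = "\<lambda>U. {e \<in> E. e \<subseteq> U}"
  have "E \<subseteq> Pow V" using E by auto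
  then have finE: "finite E" using fin by (meson finite_Pow_iff finite_subset)
  define Q where "Q U \<longleftrightarrow> U \<subseteq> V \<and> card (?e U) > k * card U" for U
  have "?e V = E" using E by auto
  then have "Q V" using surplus by (simp add: Q_def)
  then obtain U where U: "Q U" and min: "\<And>U'. Q U' \<Longrightarrow> card U \<le> card U'"
    using ex_has_least_nat[of Q V card] by blast
  have UV: "U \<subseteq> V" and big: "card (?e U) > k * card U" using U by (auto simp: Q_def)
  have finU: "finite U" using UV fin by (rule finite_subset)
  \<comment> \<open>An edge inside \<open>U\<close> provides a vertex to serve as the root of the
    balls.\<close>
  have "?e U \<noteq> {}"
  proof
    assume "?e U = {}"
    then have "k * card U < 0" using big by (metis card.empty of_nat_0)
    then show False using k by (simp add: mult_less_0_iff)
  qed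
  then obtain e where "e \<in> E" "e \<subseteq> U" by auto
  then obtain v where v: "v \<in> U" using E by fastforce
  have "k * card S \<le> card {e \<in> ?e U. e \<inter> S \<noteq> {}}" if S: "S \<subseteq> U" "S \<noteq> {}" for S
  proof -
    have finS: "finite S" using S finU finite_subset by auto
    have "card (U - S) < card U"
      using S finU by (intro psubset_card_mono) auto
    \<comment> \<open>Deleting \<open>S\<close> destroys exactly the edges meeting \<open>S\<close>.
      By minimality at most \<open>k * card (U - S)\<close> edges remain, so more than
      \<open>k * card S\<close> were destroyed.\<close>
    then have "\<not> Q (U - S)" using min by (meson not_le)
    then have le: "card (?e (U - S)) \<le> k * card (U - S)" using UV by (auto simp: Q_def)
    have split: "?e U = ?e (U - S) \<union> {e \<in> ?e U. e \<inter> S \<noteq> {}}" by auto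
    have "card (?e U) = card (?e (U - S)) + card {e \<in> ?e U. e \<inter> S \<noteq> {}}"
      by (subst split, rule card_Un_disjoint) (use finE in auto)
    moreover have "card U = card (U - S) + card S"
      using S finU finS by (simp add: card_Diff_subset card_mono)
    ultimately show ?thesis using big le by (simp add: distrib_left)
  qed
  moreover have "k ^ r > card U"
    using r card_mono[OF fin UV] by linarith
  ultimately obtain c where "graph_cycle (?e U) c" "length c \<le> 2 * r"
    using short_cycle_of_expansion[of U "?e U" v k r] finU v k E by auto
  then show ?thesis by (auto simp: graph_cycle_def)
qed

section \<open>Random vertex sets\<close>

text \<open>The weights are the distribution of a random set containing each vertex independently
  with probability \<open>q\<close>. Once \<open>A\<close> is included, the rest is such a random
  subset of \<open>V - A\<close>, and its weights sum to 1 by expanding a product of factors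
  \<open>q + (1 - q)\<close>.\<close>

lemma sum_random_subset_superset:
  fixes q :: real
  assumes "finite V" "A \<subseteq> V"
  shows "(\<Sum>W\<in>Pow V. q ^ card W * (1 - q) ^ card (V - W) * of_bool (A \<subseteq> W)) = q ^ card A"
proof -
  have finA: "finite A" using assms finite_subset by auto
  have "(\<Sum>W\<in>Pow V. q ^ card W * (1 - q) ^ card (V - W) * of_bool (A \<subseteq> W))
      = (\<Sum>W\<in>{W \<in> Pow V. A \<subseteq> W}. q ^ card W * (1 - q) ^ card (V - W))"
    using assms by (simp add: Int_def)
  also have "\<dots> = (\<Sum>W\<in>Pow (V - A). q ^ card A * (q ^ card W * (1 - q) ^ card (V - A - W)))"
  proof (rule sum.reindex_bij_witness[of _ "\<lambda>W. A \<union> W" "\<lambda>W. W - A"])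
    fix W assume W: "W \<in> {W \<in> Pow V. A \<subseteq> W}"
    then have "finite W" using assms finite_subset by auto
    then have "card W = card A + card (W - A)"
      using W finA by (simp add: card_Diff_subset card_mono)
    moreover have "V - A - (W - A) = V - W" using W by auto
    ultimately show "q ^ card A * (q ^ card (W - A) * (1 - q) ^ card (V - A - (W - A)))
        = q ^ card W * (1 - q) ^ card (V - W)"
      by (simp add: power_add)
  qed (use assms in auto)
  also have "\<dots> = q ^ card A * (\<Prod>x\<in>V - A. q + (1 - q))"
    using assms by (subst prod_add) (auto simp: sum_distrib_left)
  finally show ?thesis by simp
qed

definition survives :: "'a set set \<Rightarrow> 'a set \<Rightarrow> bool" where
  "survives T W \<longleftrightarrow> (\<exists>e\<in>T. e \<subseteq> W)"

text \<open>Inclusion-exclusion at \<open>q = 3/4\<close>: a matching gives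
  \<open>2 * 9/16 - 81/256 = 207/256\<close>, a triangle
  \<open>3 * 9/16 - 2 * 27/64 = 216/256\<close>.\<close>

lemma survival_probability:
  assumes "finite V" "\<And>e. e \<in> T \<Longrightarrow> e \<subseteq> V"
    and T: "(matching T \<and> card T = 2) \<or> triangle_edges T"
  shows "(\<Sum>W\<in>Pow V. (3/4) ^ card W * (1 - 3/4) ^ card (V - W) * of_bool (survives T W))
           \<ge> (207/256 :: real)"
proof -
  define w :: "'a set \<Rightarrow> real" where "w W = (3/4) ^ card W * (1 - 3/4) ^ card (V - W)" for W
  have w: "w W \<ge> 0" for W by (simp add: w_def)
  have prob: "(\<Sum>W\<in>Pow V. w W * of_bool (A \<subseteq> W)) = (3/4) ^ card A" if "A \<subseteq> V" for A
    unfolding w_def using sum_random_subset_superset[OF assms(1) that, of "3/4"] .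
  from T have "(\<Sum>W\<in>Pow V. w W * of_bool (survives T W)) \<ge> 207/256"
  proof
    assume M: "matching T \<and> card T = 2"
    then obtain e f where T2: "T = {e, f}" "e \<noteq> f" by (auto simp: card_2_iff)
    have d: "card e = 2" "card f = 2" "e \<inter> f = {}"
      using M T2 by (auto simp: matching_def pairwise_def disjnt_def)
    then have c: "card (e \<union> f) = 4"
      by (subst card_Un_disjoint) (auto intro: card_ge_0_finite)
    have V: "e \<subseteq> V" "f \<subseteq> V" "e \<union> f \<subseteq> V" using assms T2 by auto
    have "(207/256 :: real) = (\<Sum>W\<in>Pow V. w W * of_bool (e \<subseteq> W))
        + (\<Sum>W\<in>Pow V. w W * of_bool (f \<subseteq> W)) - (\<Sum>W\<in>Pow V. w W * of_bool (e \<union> f \<subseteq> W))"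
      unfolding prob[OF V(1)] prob[OF V(2)] prob[OF V(3)] d c by (simp add: power_numeral_reduce)
    also have "\<dots> = (\<Sum>W\<in>Pow V. w W *
        (of_bool (e \<subseteq> W) + of_bool (f \<subseteq> W) - of_bool (e \<union> f \<subseteq> W)))"
      by (simp add: sum.distrib sum_subtractf algebra_simps)
    also have "\<dots> \<le> (\<Sum>W\<in>Pow V. w W * of_bool (survives T W))"
      by (intro sum_mono mult_left_mono w) (auto simp: survives_def T2)
    finally show ?thesis .
  next
    assume "triangle_edges T"
    then obtain a b c where T3: "T = {{a, b}, {b, c}, {a, c}}" and d: "a \<noteq> b" "b \<noteq> c" "a \<noteq> c"
      by (auto simp: triangle_edges_def)
    have V: "{a, b} \<subseteq> V" "{b, c} \<subseteq> V" "{a, c} \<subseteq> V" "{a, b, c} \<subseteq> V" using assms T3 by auto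
    have "(207/256 :: real) \<le> (\<Sum>W\<in>Pow V. w W * of_bool ({a, b} \<subseteq> W))
        + (\<Sum>W\<in>Pow V. w W * of_bool ({b, c} \<subseteq> W)) + (\<Sum>W\<in>Pow V. w W * of_bool ({a, c} \<subseteq> W))
        - 2 * (\<Sum>W\<in>Pow V. w W * of_bool ({a, b, c} \<subseteq> W))"
      unfolding prob[OF V(1)] prob[OF V(2)] prob[OF V(3)] prob[OF V(4)]
      using d by (simp add: power_numeral_reduce)
    \<comment> \<open>Two edges of the triangle already cover all its vertices, so \<open>W\<close>
      contains 0, 1 or 3 of the edges; subtracting 2 in the last case leaves the indicator of
      survival.\<close>
    also have "\<dots> = (\<Sum>W\<in>Pow V. w W * (of_bool ({a, b} \<subseteq> W) + of_bool ({b, c} \<subseteq> W)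
        + of_bool ({a, c} \<subseteq> W) - 2 * of_bool ({a, b, c} \<subseteq> W)))"
      by (simp add: sum.distrib sum_subtractf sum_distrib_left algebra_simps del: insert_subset)
    also have "\<dots> \<le> (\<Sum>W\<in>Pow V. w W * of_bool (survives T W))"
      by (intro sum_mono mult_left_mono w) (auto simp: survives_def T3)
    finally show ?thesis .
  qed
  then show ?thesis by (simp add: w_def)
qed

text \<open>First moment method: if every \<open>W\<close> failed, then averaging would bound the
  expected number of surviving colors by 17/16 times the expected size of \<open>W\<close>.\<close>

lemma exists_dense_vertex_set:
  fixes V :: "'a set" and F :: "'i \<Rightarrow> 'a set set"
  assumes "finite V" "finite I" "I \<noteq> {}" "card V \<le> card I"
    and "\<And>i e. i \<in> I \<Longrightarrow> e \<in> F i \<Longrightarrow> e \<subseteq> V"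
    and "\<And>i. i \<in> I \<Longrightarrow> (matching (F i) \<and> card (F i) = 2) \<or> triangle_edges (F i)"
  shows "\<exists>W\<subseteq>V. real (card {i \<in> I. survives (F i) W}) > 17/16 * card W"
proof (rule ccontr)
  define w :: "'a set \<Rightarrow> real" where "w W = (3/4) ^ card W * (1 - 3/4) ^ card (V - W)" for W
  assume "\<not> ?thesis"
  then have le: "real (card {i \<in> I. survives (F i) W}) \<le> 17/16 * card W" if "W \<subseteq> V" for W
    using that by (auto simp: not_less)
  have "207/256 * real (card I) \<le> (\<Sum>i\<in>I. \<Sum>W\<in>Pow V. w W * of_bool (survives (F i) W))"
    using sum_bounded_below[of I "207/256" "\<lambda>i. \<Sum>W\<in>Pow V. w W * of_bool (survives (F i) W)"]
      survival_probability[of V "F _"] assms by (simp add: w_def mult.commute)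
  also have "\<dots> = (\<Sum>W\<in>Pow V. w W * real (card {i \<in> I. survives (F i) W}))"
    using assms(2) by (subst sum.swap) (simp add: sum_distrib_left[symmetric] Int_def)
  also have "\<dots> \<le> (\<Sum>W\<in>Pow V. w W * (17/16 * card W))"
    by (intro sum_mono mult_left_mono le) (auto simp: w_def)
  \<comment> \<open>Writing the size of \<open>W\<close> as a sum of indicators of
    \<open>{v} \<subseteq> W\<close> reduces its expectation to the superset formula for
    singletons.\<close>
  also have "\<dots> = 17/16 * (\<Sum>W\<in>Pow V. w W * (\<Sum>v\<in>V. of_bool ({v} \<subseteq> W)))"
    unfolding sum_distrib_left
  proof (intro sum.cong refl)
    fix W assume "W \<in> Pow V"
    then have "V \<inter> {v. v \<in> W} = W" by auto
    then have "(\<Sum>v\<in>V. of_bool ({v} \<subseteq> W)) = real (card W)"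
      using assms(1) by simp
    then show "w W * (17/16 * card W) = (\<Sum>v\<in>V. 17/16 * (w W * of_bool ({v} \<subseteq> W)))"
      unfolding sum_distrib_left[symmetric] by simp
  qed
  also have "\<dots> = 17/16 * (\<Sum>v\<in>V. \<Sum>W\<in>Pow V. w W * of_bool ({v} \<subseteq> W))"
    unfolding sum_distrib_left by (subst sum.swap) simp
  also have "\<dots> = 17/16 * (\<Sum>v\<in>V. 3/4)"
  proof -
    have "(\<Sum>W\<in>Pow V. w W * of_bool ({v} \<subseteq> W)) = 3/4" if "v \<in> V" for v
      unfolding w_def using sum_random_subset_superset[OF assms(1), of "{v}" "3/4"] that by simp
    from sum.cong[OF refl this] show ?thesis by (rule arg_cong)
  qed
  \<comment> \<open>Here \<open>51/64 = 17/16 * 3/4 = 204/256\<close>, just below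
    \<open>207/256\<close>.\<close>
  finally have "207/256 * real (card I) \<le> 51/64 * real (card V)" by simp
  moreover have "real (card V) \<le> real (card I)" "real (card I) > 0"
    using assms by (auto simp: card_gt_0_iff)
  ultimately show False by linarith
qed

section \<open>Rainbow girth\<close>

lemma short_rainbow_cycle:
  assumes "n > 0" "simple_graph V E" "card V = n" "edge_coloring E n F"
    and F: "\<forall>i\<in>{1..n}. (matching (F i) \<and> card (F i) = 2) \<or> triangle_edges (F i)"
    and r: "(17/16 :: real) ^ r > n"
  shows "\<exists>c. graph_cycle E c \<and> rainbow n F (cycle_edges c) \<and> length c \<le> 2 * r"
proof -
  have fin: "finite V" and E: "\<And>e. e \<in> E \<Longrightarrow> e \<subseteq> V \<and> card e = 2"
    using assms(2) by (auto simp: simple_graph_def)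
  have FE: "F i \<subseteq> E" if "i \<in> {1..n}" for i using assms(4) that by (auto simp: edge_coloring_def)
  obtain W where W: "W \<subseteq> V" "real (card {i \<in> {1..n}. survives (F i) W}) > 17/16 * card W"
  proof -
    have "e \<subseteq> V" if "i \<in> {1..n}" "e \<in> F i" for i e using that FE E by blast
    then show ?thesis
      using exists_dense_vertex_set[of V "{1..n}" F] fin assms(1,3) F that by auto
  qed
  define I where "I = {i \<in> {1..n}. survives (F i) W}"
  have "\<forall>i\<in>I. \<exists>e. e \<in> F i \<and> e \<subseteq> W" by (auto simp: I_def survives_def)
  then obtain g where g: "\<And>i. i \<in> I \<Longrightarrow> g i \<in> F i \<and> g i \<subseteq> W" by metis
  have same: "i = j" if "e \<in> F i" "e \<in> F j" "i \<in> {1..n}" "j \<in> {1..n}" for i j e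
    using assms(4) that unfolding edge_coloring_def disjoint_family_on_def by blast
  \<comment> \<open>Injectivity turns the surplus of colors into a surplus of edges.\<close>
  have "inj_on g I"
  proof (rule inj_onI)
    fix i j assume "i \<in> I" "j \<in> I" "g i = g j"
    then show "i = j" using same[of "g i" i j] g[of i] g[of j] by (simp add: I_def)
  qed
  then have surplus: "real (card (g ` I)) > 17/16 * card W"
    using W(2) by (simp add: card_image I_def)
  have gE: "g ` I \<subseteq> E" using g FE by (auto simp: I_def)
  have "finite W" using W(1) fin by (rule finite_subset)
  moreover have "e \<subseteq> W \<and> card e = 2" if "e \<in> g ` I" for e using that g gE E by auto
  moreover have "(17/16 :: real) ^ r > card W" using card_mono[OF fin W(1)] assms(3) r by simp
  ultimately obtain c where c: "graph_cycle (g ` I) c" "length c \<le> 2 * r"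
    using short_cycle_of_surplus[of W "g ` I" "17/16" r] surplus by auto
  have "card (cycle_edges c \<inter> F i) \<le> 1" if i: "i \<in> {1..n}" for i
  proof -
    \<comment> \<open>For \<open>i\<close> outside \<open>I\<close> the value \<open>g i\<close> is
      arbitrary, but then the intersection is empty.\<close>
    have "cycle_edges c \<inter> F i \<subseteq> {g i}"
    proof
      fix e assume e: "e \<in> cycle_edges c \<inter> F i"
      then obtain j where j: "j \<in> I" "e = g j" using c(1) by (auto simp: graph_cycle_def)
      then have "j = i" using same[of e j i] g e i by (auto simp: I_def)
      then show "e \<in> {g i}" using j by simp
    qed
    from card_mono[OF _ this] show ?thesis by simp
  qed
  then have "rainbow n F (cycle_edges c)" by (simp add: rainbow_def)
  moreover have "graph_cycle E c" using c(1) gE by (auto simp: graph_cycle_def)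
  ultimately show ?thesis using c(2) by blast
qed

lemma exists_power_greater:
  fixes x k :: real
  assumes "x \<ge> 1" "k > 1"
  shows "\<exists>r. k ^ r > x \<and> real r \<le> ln x / ln k + 1"
proof -
  let ?y = "ln x / ln k"
  define r where "r = Suc (nat \<lfloor>?y\<rfloor>)"
  have y: "?y \<ge> 0" using assms by simp
  then have r: "?y < real r" "real r \<le> ?y + 1" by (auto simp: r_def) linarith+
  then have "ln x < real r * ln k" using assms by (simp add: divide_simps)
  also have "\<dots> = ln (k ^ r)" using assms by (simp add: ln_realpow)
  finally have "x < k ^ r" using assms by simp
  then show ?thesis using r by blast
qed

theorem theorem14:
  "\<exists>C::real. C > 0 \<and>
     (\<forall>(n::nat) (V::'a set) E F.
        n > 0 \<longrightarrow> simple_graph V E \<longrightarrow> card V = n \<longrightarrow> edge_coloring E n F \<longrightarrow>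
        (\<forall>i\<in>{1..n}. (matching (F i) \<and> card (F i) = 2) \<or> triangle_edges (F i)) \<longrightarrow>
        ereal_of_enat (rgirth E n F) \<le> ereal (C * ln (real n)))"
proof (intro exI conjI allI impI)
  \<comment> \<open>The cycle length is at most \<open>2 * r\<close>, with \<open>r\<close> at most
    \<open>ln n / ln (17/16) + 1\<close>. The second summand of \<open>?C\<close> absorbs the
    additive 2.\<close>
  let ?C = "2 / ln (17/16) + 2 / ln 2 :: real"
  show "?C > 0" by (simp add: add_pos_pos)
  fix n :: nat and V :: "'a set" and E F
  assume A: "n > 0" "simple_graph V E" "card V = n" "edge_coloring E n F"
    "\<forall>i\<in>{1..n}. (matching (F i) \<and> card (F i) = 2) \<or> triangle_edges (F i)"
  obtain r where r: "(17/16 :: real) ^ r > n" "real r \<le> ln n / ln (17/16) + 1"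
    using exists_power_greater[of "real n" "17/16"] A(1) by auto
  obtain c where c: "graph_cycle E c" "rainbow n F (cycle_edges c)" "length c \<le> 2 * r"
    using short_rainbow_cycle[OF A r(1)] by blast
  \<comment> \<open>At \<open>n = 1\<close> the claimed bound would be 0. The existence of an edge
    rules this case out and gives \<open>ln n / ln 2 \<ge> 1\<close>.\<close>
  have "{c ! 0, c ! (Suc 0 mod length c)} \<in> cycle_edges c"
    using c(1) unfolding graph_cycle_def cycle_edges_def by fastforce
  then obtain e where "e \<in> E" using c(1) by (auto simp: graph_cycle_def)
  then have "2 \<le> n" using A(2,3) by (metis card_mono simple_graph_def)
  then have "ln 2 \<le> ln (real n)" by simp
  then have "1 \<le> ln n / ln 2" by (simp add: divide_simps)
  moreover have "real (length c) \<le> 2 * (ln n / ln (17/16)) + 2"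
    using c(3) r(2) by linarith
  ultimately have "real (length c) \<le> 2 * (ln n / ln (17/16)) + 2 * (ln n / ln 2)"
    by linarith
  also have "\<dots> = ?C * ln n" by (simp add: distrib_right)
  finally have "real (length c) \<le> ?C * ln n" .
  moreover have "rgirth E n F \<le> enat (length c)"
    unfolding rgirth_def using c by (intro Inf_lower) auto
  then have "ereal_of_enat (rgirth E n F) \<le> ereal (real (length c))"
    using ereal_of_enat_le_iff[of "rgirth E n F" "enat (length c)"] by simp
  ultimately show "ereal_of_enat (rgirth E n F) \<le> ereal (?C * ln n)"
    by (meson ereal_less_eq(3) order_trans)
qed

end
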